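(* Let $\hat\theta_k^{\rm cyc}$ and $\hat\theta_k^{\rm non}$ be the iterates of the strictly cyclic algorithm and of its non-cyclic counterpart described in the context, let $c^{\rm cyc},c^{\rm non}\in(0,\infty)$ be their (iteration-independent) per-iteration costs with $c^{\rm cyc}/c^{\rm non}$ rational, and let $\{(k_{1(i)},k_{2(i)})\}_{i\ge1}\subset\mathbb Z^+\times\mathbb Z^+$ be strictly increasing in each coordinate with $c^{\rm cyc}k_{1(i)}=c^{\rm non}k_{2(i)}$ for all $i$. Assume: (E0) The cyclic conditions and the non-cyclic conditions listed in the context (together with the conditions common to both) hold. (E1) $\beta>0$ and the gains $a_k^{(j)}>0$, $j=1,\dots,d$, are the same for both algorithms. (E2) $b^{\rm cyc}=b^{\rm non}$ (e.g., as when the noisy gradients are unbiased in both algorithms). (E3) At least one of the following holds: (i) $S=cI$ for some constant $c$ (i.e., $H(\theta^* )$ is a diagonal matrix); (ii) $M_B=M$ (e.g., when the entries of $\xi_k$ are independent given $\mathcal F_k$). Then $$\lim_{i\to\infty}\frac{E\|\hat\theta^{\rm cyc}_{k_{1(i)}}-\theta^*\|^2}{E\|\hat\theta^{\rm non}_{k_{2(i)}}-\theta^*\|^2}=\Big(\frac{c^{\rm cyc}}{c^{\rm non}}\Big)^\beta.$$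
   Context: $\|\cdot\|$ is the Euclidean/Frobenius norm; $\chi$ denotes an indicator; w.p.1 means with probability one; "$C>\|X_k\|\to0$" means $\|X_k\|<C$ for all $k$ and $\|X_k\|\to0$. $L:\mathbb R^p\to\mathbb R$ has gradient $g$, Hessian $H$, and $g(\theta^* )=0$. $\mathcal S_1,\dots,\mathcal S_d$ are pairwise disjoint with union $\{1,\dots,p\}$; $v^{(j)}$ is $v\in\mathbb R^p$ with entries outside $\mathcal S_j$ replaced by $0$. Noisy gradients are $\hat g_k(\theta)=g(\theta)+\beta_k(\theta)+\xi_k(\theta)$ (bias plus noise; the vector $\beta_k(\cdot)$ is distinct from the scalar $\beta$). Cyclic algorithm: $\hat\theta_k^{(I_0)}=\hat\theta_k^{\rm cyc}$, $\hat\theta_k^{(I_j)}=\hat\theta_k^{(I_{j-1})}-a_k^{(j)}\hat g_k^{(j)}(\hat\theta_k^{(I_{j-1})})$ for $j=1,\dots,d$, $\hat\theta^{\rm cyc}_{k+1}=\hat\theta_k^{(I_d)}$. Non-cyclic algorithm: $\hat\theta^{\rm non}_{k+1}=\hat\theta^{\rm non}_k-A_k\hat g_k(\hat\theta_k^{\rm non})$, where $A_k$ is diagonal with $i$th diagonal entry $a_k^{(j)}$ for the $j$ with $i\in\mathcal S_j$. For each algorithm $\mathcal F_k$ is the $\sigma$-field generated by its iterates up to index $k$ and any random variables generated in producing the $k$th iterate. Conditions common to both: $L$ is twice continuously differentiable and $H(\theta)$ has bounded entries; $a_k^{(j)}>0$ and $k^\alpha a_k^{(j)}\to r_j<\infty$;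 $AH(\theta^* )=S\Lambda S^{-1}$ with $S$ real nonsingular, $\Lambda$ real diagonal with strictly positive diagonal, and $A$ diagonal with $i$th entry $r_j$ for $i\in\mathcal S_j$; $0<\beta\le\alpha\le1$; $\beta_+<2\min_i\Lambda_{ii}$ with $\beta_+=\beta$ if $\alpha=1$ and $\beta_+=0$ otherwise. Cyclic conditions (in addition): $\hat\theta_k^{(I_j)}\to\theta^*$ w.p.1 for all $j$; with $\xi_k^j=\xi_k^{(j)}(\hat\theta_k^{(I_{j-1})})$: $k^{\beta/2}\beta_k^{(j)}(\hat\theta_k^{(I_{j-1})})\to b^{(j)}$ w.p.1 (finite vectors), and $b^{\rm cyc}=\sum_jb^{(j)}$; $E[\xi_k^j\mid\hat\theta_k^{(I_{j-1})}]=0$; for some $C>0$ and matrices $\Sigma^{(j)}$, w.p.1, $C>\|k^{\beta-\alpha}E[\xi_k^j(\xi_k^j)^\top\mid\mathcal F_k]-\Sigma^{(j)}\|\to0$ and $C>\|k^{\beta-\alpha}E[\xi_k^j(\xi_k^{j'})^\top\mid\mathcal F_k]\|\to0$ for $j\ne j'$; with $M_B=\sum_{j=1}^d\Sigma^{(j)}$, $AM_BA$ is positive definite; for every $r>0$ and $j$, $E[\chi\{\|Y_k\|^2\ge rk^\alpha\}\|Y_k\|^2]\to0$ with $Y_k=k^{(\beta-\alpha)/2}\xi_k^j$. Non-cyclic conditions (in addition): $\hat\theta_k^{\rm non}\to\theta^*$ w.p.1; $k^{\beta/2}\beta_k(\hat\theta_k^{\rm non})\to b^{\rm non}$ w.p.1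 (finite vector); $E[\xi_k(\hat\theta_k^{\rm non})\mid\hat\theta_k^{\rm non}]=0$; for some $C>0$ and matrix $M$, w.p.1, $C>\|k^{\beta-\alpha}E[\xi_k(\hat\theta_k^{\rm non})\xi_k(\hat\theta_k^{\rm non})^\top\mid\mathcal F_k]-M\|\to0$; $AMA$ is positive definite; for every $r>0$, $E[\chi\{\|Y_k\|^2\ge rk^\alpha\}\|Y_k\|^2]\to0$ with $Y_k=k^{(\beta-\alpha)/2}\xi_k(\hat\theta_k^{\rm non})$. Under these conditions $k^{\beta/2}(\hat\theta_k^{\rm cyc}-\theta^* )$ and $k^{\beta/2}(\hat\theta_k^{\rm non}-\theta^* )$ converge in distribution to $\mathcal N(\mu^{\rm cyc},\Sigma^{\rm cyc})$ and $\mathcal N(\mu^{\rm non},\Sigma^{\rm non})$, where for $*\in\{{\rm cyc},{\rm non}\}$, $\mu^*=-S[\Lambda-(\beta_+/2)I]^{-1}S^{-1}Ab^*$ and $\Sigma^*=SQ^*S^\top$ with $Q^{\rm cyc}_{ij}=[S^{-1}AM_BA(S^{-1})^\top]_{ij}/(\Lambda_{ii}+\Lambda_{jj}-\beta_+)$ and $Q^{\rm non}_{ij}=[S^{-1}AMA(S^{-1})^\top]_{ij}/(\Lambda_{ii}+\Lambda_{jj}-\beta_+)$. Standing assumption: the means and covariance matrices of $k^{\beta/2}(\hat\theta_k^*-\theta^* )$ converge to $\mu^*$ and $\Sigma^*$, for $*\in\{{\rm cyc},{\rm non}\}$.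
   Formalization: The formal theorem also assumes that M_B and M have equal diagonal entries; this is automatic under (ii), but under (i) the listed conditions do not imply it and the claim fails without it (e.g. p = d = 1 with M_B = 1, M = 4). *)

theory Defs
  imports "HOL-Probability.Probability"
begin

definition block_part :: "'p set \<Rightarrow> real ^ 'p \<Rightarrow> real ^ 'p" where
  "block_part B v = (\<chi> i. if i \<in> B then v $ i else 0)"

text \<open>Blocks are indexed by \<open>1, \<dots>, d\<close>. The description is meaningful when these
  blocks partition the coordinates.\<close>

definition block_of :: "nat \<Rightarrow> (nat \<Rightarrow> 'p set) \<Rightarrow> 'p \<Rightarrow> nat" where
  "block_of d blk i = (THE j. j \<in> {1..d} \<and> i \<in> blk j)"

definition gain_matrix :: "nat \<Rightarrow> (nat \<Rightarrow> 'p set) \<Rightarrow> (nat \<Rightarrow> real) \<Rightarrow> real ^ 'p ^ 'p" where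
  "gain_matrix d blk c = (\<chi> i l. if i = l then c (block_of d blk i) else 0)"

definition pos_def :: "real ^ 'p ^ 'p \<Rightarrow> bool" where
  "pos_def X \<longleftrightarrow> transpose X = X \<and> (\<forall>v. v \<noteq> 0 \<longrightarrow> 0 < v \<bullet> (X *v v))"

text \<open>A random vector field \<open>f k x \<omega>\<close> is evaluated along random points. In the cyclic
  algorithm the \<open>j\<close>-th block of \<open>f k\<close> is evaluated at the \<open>(j - 1)\<close>-st intermediate iterate
  \<open>\<theta>I k (j - 1)\<close>; in the non-cyclic one \<open>f k\<close> is evaluated at the \<open>k\<close>-th iterate \<open>\<theta> k\<close>.\<close>

definition cyc_eval ::
  "(nat \<Rightarrow> 'p set) \<Rightarrow> (nat \<Rightarrow> real ^ 'p \<Rightarrow> 'w \<Rightarrow> real ^ 'p) \<Rightarrow> (nat \<Rightarrow> nat \<Rightarrow> 'w \<Rightarrow> real ^ 'p)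
    \<Rightarrow> nat \<Rightarrow> nat \<Rightarrow> 'w \<Rightarrow> real ^ 'p" where
  "cyc_eval blk f \<theta>I k j = (\<lambda>\<omega>. block_part (blk j) (f k (\<theta>I k (j - 1) \<omega>) \<omega>))"

definition non_eval ::
  "(nat \<Rightarrow> real ^ 'p \<Rightarrow> 'w \<Rightarrow> real ^ 'p) \<Rightarrow> (nat \<Rightarrow> 'w \<Rightarrow> real ^ 'p) \<Rightarrow> nat \<Rightarrow> 'w \<Rightarrow> real ^ 'p" where
  "non_eval f \<theta> k = (\<lambda>\<omega>. f k (\<theta> k \<omega>) \<omega>)"

definition coords :: "('w \<Rightarrow> real ^ 'p) \<Rightarrow> ('w \<Rightarrow> real) set" where
  "coords X = range (\<lambda>i \<omega>. X \<omega> $ i)"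

definition generated_sigma :: "'w set \<Rightarrow> ('w \<Rightarrow> real) set \<Rightarrow> 'w measure" where
  "generated_sigma \<Omega> Xs = sigma \<Omega> {X -` B \<inter> \<Omega> | X B. X \<in> Xs \<and> B \<in> sets borel}"

text \<open>The \<open>\<sigma>\<close>-field generated by the iterates up to index \<open>k\<close> and the random variables \<open>V k\<close>
  generated in producing the \<open>k\<close>-th iterate.\<close>

definition history ::
  "'w measure \<Rightarrow> (nat \<Rightarrow> 'w \<Rightarrow> real ^ 'p) \<Rightarrow> (nat \<Rightarrow> ('w \<Rightarrow> real) set) \<Rightarrow> nat \<Rightarrow> 'w measure" where
  "history P \<theta> V k = generated_sigma (space P) ((\<Union>m\<le>k. coords (\<theta> m)) \<union> V k)"

text \<open>Conditional expectations are taken componentwise. \<open>real_cond_exp\<close> is only meaningful for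
  integrable arguments, so integrability has to be required wherever these are used.\<close>

definition cond_mean_zero :: "'w measure \<Rightarrow> ('w \<Rightarrow> real ^ 'p) \<Rightarrow> ('w \<Rightarrow> real ^ 'p) \<Rightarrow> bool" where
  "cond_mean_zero P X Y \<longleftrightarrow>
    (AE \<omega> in P. \<forall>i. real_cond_exp P (vimage_algebra (space P) Y borel) (\<lambda>\<omega>. X \<omega> $ i) \<omega> = 0)"

definition cond_cross_moment ::
  "'w measure \<Rightarrow> 'w measure \<Rightarrow> ('w \<Rightarrow> real ^ 'p) \<Rightarrow> ('w \<Rightarrow> real ^ 'p) \<Rightarrow> 'w \<Rightarrow> real ^ 'p ^ 'p" where
  "cond_cross_moment P F X Y \<omega> = (\<chi> i l. real_cond_exp P F (\<lambda>\<omega>. X \<omega> $ i * Y \<omega> $ l) \<omega>)"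

text \<open>With probability one, \<open>C > \<parallel>X k\<parallel>\<close> for all \<open>k\<close> and \<open>\<parallel>X k\<parallel> \<longlongrightarrow> 0\<close>. The index starts at \<open>1\<close>
  since \<open>X k\<close> will contain a real power of \<open>k\<close> (and \<open>0 powr 0 = 0\<close>). On matrices \<open>norm\<close> is the
  Frobenius norm.\<close>

definition bounded_null ::
  "'w measure \<Rightarrow> real \<Rightarrow> (nat \<Rightarrow> 'w \<Rightarrow> 'b::real_normed_vector) \<Rightarrow> bool" where
  "bounded_null P C X \<longleftrightarrow>
    (AE \<omega> in P. (\<forall>k\<ge>1. norm (X k \<omega>) < C) \<and> (\<lambda>k. norm (X k \<omega>)) \<longlonglongrightarrow> 0)"

definition lindeberg_condition ::
  "'w measure \<Rightarrow> real \<Rightarrow> (nat \<Rightarrow> 'w \<Rightarrow> real ^ 'p) \<Rightarrow> bool" where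
  "lindeberg_condition P \<alpha> Y \<longleftrightarrow>
    (\<forall>\<rho>>0. (\<lambda>k. \<integral>\<omega>. indicator {\<omega>. (norm (Y k \<omega>))\<^sup>2 \<ge> \<rho> * real k powr \<alpha>} \<omega>
                     * (norm (Y k \<omega>))\<^sup>2 \<partial>P) \<longlonglongrightarrow> 0)"

definition cov_matrix :: "'w measure \<Rightarrow> ('w \<Rightarrow> real ^ 'p) \<Rightarrow> real ^ 'p ^ 'p" where
  "cov_matrix P X = (\<chi> i l. \<integral>\<omega>. (X \<omega> $ i - (\<integral>\<omega>'. X \<omega>' $ i \<partial>P))
                               * (X \<omega> $ l - (\<integral>\<omega>'. X \<omega>' $ l \<partial>P)) \<partial>P)"

text \<open>Square integrability makes the means and the covariance matrices exist.\<close>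

definition moments_converge ::
  "'w measure \<Rightarrow> (nat \<Rightarrow> 'w \<Rightarrow> real ^ 'p) \<Rightarrow> real ^ 'p \<Rightarrow> real ^ 'p ^ 'p \<Rightarrow> bool" where
  "moments_converge P X \<mu> V \<longleftrightarrow>
    (\<forall>k. integrable P (\<lambda>\<omega>. (norm (X k \<omega>))\<^sup>2)) \<and>
    (\<lambda>k. \<integral>\<omega>. X k \<omega> \<partial>P) \<longlonglongrightarrow> \<mu> \<and>
    (\<lambda>k. cov_matrix P (X k)) \<longlonglongrightarrow> V"

definition beta_plus :: "real \<Rightarrow> real \<Rightarrow> real" where
  "beta_plus \<alpha> \<beta> = (if \<alpha> = 1 then \<beta> else 0)"

definition limit_mean ::
  "real ^ 'p ^ 'p \<Rightarrow> real ^ 'p ^ 'p \<Rightarrow> real \<Rightarrow> real ^ 'p ^ 'p \<Rightarrow> real ^ 'p \<Rightarrow> real ^ 'p" where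
  "limit_mean S \<Lambda> \<beta>p A b = - ((S ** matrix_inv (\<Lambda> - mat (\<beta>p / 2)) ** matrix_inv S ** A) *v b)"

definition limit_Q ::
  "real ^ 'p ^ 'p \<Rightarrow> real ^ 'p ^ 'p \<Rightarrow> real \<Rightarrow> real ^ 'p ^ 'p \<Rightarrow> real ^ 'p ^ 'p \<Rightarrow> real ^ 'p ^ 'p" where
  "limit_Q S \<Lambda> \<beta>p A M =
    (\<chi> i l. (matrix_inv S ** A ** M ** A ** transpose (matrix_inv S)) $ i $ l
             / (\<Lambda> $ i $ i + \<Lambda> $ l $ l - \<beta>p))"

definition limit_cov ::
  "real ^ 'p ^ 'p \<Rightarrow> real ^ 'p ^ 'p \<Rightarrow> real \<Rightarrow> real ^ 'p ^ 'p \<Rightarrow> real ^ 'p ^ 'p \<Rightarrow> real ^ 'p ^ 'p" where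
  "limit_cov S \<Lambda> \<beta>p A M = S ** limit_Q S \<Lambda> \<beta>p A M ** transpose S"

end

theory Submission
  imports Defs
begin

text \<open>The ratio of mean square errors is a statement about second moments only. By the
  bias--variance decomposition the second moment of \<open>k\<^sup>\<beta>\<^sup>/\<^sup>2(\<theta>\<^sub>k - \<theta>\<^sup>*)\<close> is the squared norm of its mean
  plus the trace of its covariance matrix, so convergence of means and covariances gives
  \<open>k\<^sup>\<beta> E\<parallel>\<theta>\<^sub>k - \<theta>\<^sup>*\<parallel>\<^sup>2 \<longlonglongrightarrow> \<parallel>\<mu>\<parallel>\<^sup>2 + tr \<Sigma>\<close> for each algorithm (\<open>scaled_mean_square_error_tendsto\<close>).
  If the two algorithms have the same positive limit \<open>c\<close>, then the ratio of their mean square errors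
  at iterations \<open>k\<^sub>1\<close> and \<open>k\<^sub>2\<close> behaves like \<open>(c / k\<^sub>1\<^sup>\<beta>) / (c / k\<^sub>2\<^sup>\<beta>) = (k\<^sub>2 / k\<^sub>1)\<^sup>\<beta>\<close>, and matching
  the costs makes \<open>k\<^sub>2 / k\<^sub>1\<close> equal to the cost ratio (\<open>tendsto_ratio_along_matched_indices\<close>).

  The limits agree: equal bias limits give equal \<open>\<mu>\<close>. The covariances are equal when \<open>M\<^sub>B = M\<close>; when
  \<open>S\<close> is a scalar matrix, all matrices surrounding \<open>M\<close> in the formula for \<open>\<Sigma>\<close> are diagonal, so the
  diagonal of \<open>\<Sigma>\<close> depends on \<open>M\<close> only through its diagonal, which \<open>M\<^sub>B\<close> shares
  (\<open>limit_cov_diag_scalar_eigenbasis\<close>).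

  The common limit is positive because \<open>tr \<Sigma> > 0\<close>. Proving from the formula alone that \<open>\<Sigma>\<close> is positive
  definite would call for a Schur product or Lyapunov argument. Instead, \<open>\<Sigma>\<close> is known to be a
  limit of covariance matrices, so its entries are dominated by its diagonal and \<open>tr \<Sigma> = 0\<close> would
  force \<open>\<Sigma> = 0\<close> (\<open>trace_limit_cov_pos\<close>). The map from \<open>AMA\<close> to \<open>\<Sigma>\<close> is injective, being composed of
  two congruences and an entrywise division, so \<open>\<Sigma> = 0\<close> would give \<open>AMA = 0\<close>, against positive
  definiteness (\<open>limit_cov_nonzero\<close>).\<close>

section \<open>Second moments and limits of covariance matrices\<close>

lemma measurable_vec_nth:
  fixes X :: "'w \<Rightarrow> real ^ 'p"
  assumes "X \<in> borel_measurable P"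
  shows "(\<lambda>\<omega>. X \<omega> $ i) \<in> borel_measurable P"
  by (rule borel_measurable_continuous_on[OF _ assms]) (intro continuous_intros)

lemma integrable_vec_nth_mult:
  fixes X :: "'w \<Rightarrow> real ^ 'p"
  assumes "X \<in> borel_measurable P" and L2: "integrable P (\<lambda>\<omega>. (norm (X \<omega>))\<^sup>2)"
  shows "integrable P (\<lambda>\<omega>. X \<omega> $ i * X \<omega> $ l)"
proof (rule Bochner_Integration.integrable_bound[OF L2])
  show "(\<lambda>\<omega>. X \<omega> $ i * X \<omega> $ l) \<in> borel_measurable P"
    by (intro borel_measurable_times measurable_vec_nth assms)
  show "AE \<omega> in P. norm (X \<omega> $ i * X \<omega> $ l) \<le> norm ((norm (X \<omega>))\<^sup>2)"
    by (simp add: abs_mult power2_eq_square mult_mono component_le_norm_cart)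
qed

context prob_space
begin

lemma integrable_of_square_integrable:
  fixes X :: "'a \<Rightarrow> 'b :: {banach, second_countable_topology}"
  assumes [measurable]: "X \<in> borel_measurable M" and L2: "integrable M (\<lambda>\<omega>. (norm (X \<omega>))\<^sup>2)"
  shows "integrable M X"
  using square_integrable_imp_integrable[of "\<lambda>\<omega>. norm (X \<omega>)"] L2
  by (simp add: integrable_norm_iff)

text \<open>The bias--variance decomposition, summed over the coordinates.\<close>

lemma second_moment_eq_norm_mean_plus_trace_cov:
  fixes X :: "'a \<Rightarrow> real ^ 'p"
  assumes meas: "X \<in> borel_measurable M" and L2: "integrable M (\<lambda>\<omega>. (norm (X \<omega>))\<^sup>2)"
  shows "(\<integral>\<omega>. (norm (X \<omega>))\<^sup>2 \<partial>M) = (norm (\<integral>\<omega>. X \<omega> \<partial>M))\<^sup>2 + trace (cov_matrix M X)"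
proof -
  note int = integrable_of_square_integrable[OF meas L2]
  have norm_sq: "(norm x)\<^sup>2 = (\<Sum>i\<in>UNIV. (x $ i)\<^sup>2)" for x :: "real ^ 'p"
    by (simp add: norm_vec_def L2_set_def sum_nonneg)
  have int_i: "integrable M (\<lambda>\<omega>. X \<omega> $ i)" for i
    using integrable_bounded_linear[OF bounded_linear_vec_nth int] .
  have int_sq: "integrable M (\<lambda>\<omega>. (X \<omega> $ i)\<^sup>2)" for i
    using integrable_vec_nth_mult[OF meas L2, of i i] by (simp add: power2_eq_square)
  have mean: "(\<integral>\<omega>. X \<omega> \<partial>M) $ i = expectation (\<lambda>\<omega>. X \<omega> $ i)" for i
    using integral_bounded_linear[OF bounded_linear_vec_nth int] by simp
  have "cov_matrix M X $ i $ i = expectation (\<lambda>\<omega>. (X \<omega> $ i)\<^sup>2) - ((\<integral>\<omega>. X \<omega> \<partial>M) $ i)\<^sup>2" for i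
    using variance_eq[OF int_i int_sq, of i] by (simp add: cov_matrix_def mean power2_eq_square)
  then show ?thesis
    by (simp add: norm_sq trace_def sum_subtractf Bochner_Integration.integral_sum int_sq)
qed

text \<open>Integrate \<open>\<bar>x y\<bar> \<le> (x\<^sup>2 + y\<^sup>2) / 2\<close>. Unlike the Cauchy--Schwarz bound this is linear in the
  covariances, and it already shows that the matrix vanishes with its diagonal.\<close>

lemma cov_matrix_entry_le_diag:
  fixes X :: "'a \<Rightarrow> real ^ 'p"
  assumes meas: "X \<in> borel_measurable M" and L2: "integrable M (\<lambda>\<omega>. (norm (X \<omega>))\<^sup>2)"
  shows "\<bar>cov_matrix M X $ i $ l\<bar> \<le> (cov_matrix M X $ i $ i + cov_matrix M X $ l $ l) / 2"
proof -
  define Y where "Y i \<omega> = X \<omega> $ i - expectation (\<lambda>\<omega>'. X \<omega>' $ i)" for i \<omega>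
  have int_i: "integrable M (\<lambda>\<omega>. X \<omega> $ i)" for i
    using integrable_bounded_linear[OF bounded_linear_vec_nth integrable_of_square_integrable[OF meas L2]] .
  have int: "integrable M (\<lambda>\<omega>. Y i \<omega> * Y l \<omega>)" for i l
    unfolding Y_def using integrable_vec_nth_mult[OF meas L2] int_i
    by (simp add: algebra_simps)
  have cov: "cov_matrix M X $ i $ l = expectation (\<lambda>\<omega>. Y i \<omega> * Y l \<omega>)" for i l
    by (simp add: cov_matrix_def Y_def)
  have "\<bar>expectation (\<lambda>\<omega>. Y i \<omega> * Y l \<omega>)\<bar> \<le> expectation (\<lambda>\<omega>. \<bar>Y i \<omega> * Y l \<omega>\<bar>)"
    by (rule integral_abs_bound)
  also have "\<dots> \<le> expectation (\<lambda>\<omega>. (Y i \<omega> * Y i \<omega> + Y l \<omega> * Y l \<omega>) / 2)"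
  proof (intro integral_mono)
    fix \<omega>
    have "0 \<le> (\<bar>Y i \<omega>\<bar> - \<bar>Y l \<omega>\<bar>)\<^sup>2" by simp
    then show "\<bar>Y i \<omega> * Y l \<omega>\<bar> \<le> (Y i \<omega> * Y i \<omega> + Y l \<omega> * Y l \<omega>) / 2"
      by (simp add: power2_diff abs_mult power2_eq_square[symmetric])
  qed (use int in auto)
  finally show ?thesis by (simp add: cov int)
qed

lemma second_moment_tendsto:
  fixes X :: "nat \<Rightarrow> 'a \<Rightarrow> real ^ 'p"
  assumes meas: "\<And>k. X k \<in> borel_measurable M" and conv: "moments_converge M X \<mu> V"
  shows "(\<lambda>k. \<integral>\<omega>. (norm (X k \<omega>))\<^sup>2 \<partial>M) \<longlonglongrightarrow> (norm \<mu>)\<^sup>2 + trace V"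
proof -
  have "(\<lambda>k. (norm (\<integral>\<omega>. X k \<omega> \<partial>M))\<^sup>2 + trace (cov_matrix M (X k)))
          \<longlonglongrightarrow> (norm \<mu>)\<^sup>2 + trace V"
    using conv unfolding moments_converge_def trace_def by (intro tendsto_intros) auto
  then show ?thesis
    using meas conv by (simp add: second_moment_eq_norm_mean_plus_trace_cov moments_converge_def)
qed

text \<open>The entrywise bound by the diagonal survives the limit; hence a nonzero entry of \<open>V\<close> forces a
  positive diagonal entry. This replaces positive definiteness of \<open>V\<close>.\<close>

lemma trace_limit_cov_pos:
  fixes X :: "nat \<Rightarrow> 'a \<Rightarrow> real ^ 'p"
  assumes meas: "\<And>k. X k \<in> borel_measurable M" and conv: "moments_converge M X \<mu> V" and "V \<noteq> 0"
  shows "0 < trace V"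
proof -
  have lim: "(\<lambda>k. cov_matrix M (X k) $ i $ l) \<longlonglongrightarrow> V $ i $ l" for i l
    using conv unfolding moments_converge_def by (intro tendsto_intros) auto
  have bound: "\<bar>V $ i $ l\<bar> \<le> (V $ i $ i + V $ l $ l) / 2" for i l
    using conv meas
    by (intro tendsto_le[OF _ tendsto_divide[OF tendsto_add[OF lim lim] tendsto_const] tendsto_rabs[OF lim]])
      (auto simp only: moments_converge_def trivial_limit_sequentially intro!: always_eventually cov_matrix_entry_le_diag)
  have nonneg: "0 \<le> V $ i $ i" for i using bound[of i i] by simp
  obtain i l where "0 < \<bar>V $ i $ l\<bar>" using \<open>V \<noteq> 0\<close> by (auto simp: vec_eq_iff)
  also note bound[of i l]
  finally have "0 < V $ i $ i + V $ l $ l" by simp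
  then have "0 < V $ i $ i \<or> 0 < V $ l $ l"
    by (rule contrapos_pp) (simp add: not_less add_nonpos_nonpos)
  then show ?thesis
    unfolding trace_def using nonneg by (auto intro: sum_pos2)
qed

lemma scaled_mean_square_error_tendsto:
  fixes \<theta> :: "nat \<Rightarrow> 'a \<Rightarrow> real ^ 'p"
  assumes meas: "\<And>k. \<theta> k \<in> borel_measurable M"
    and conv: "moments_converge M (\<lambda>k \<omega>. real k powr (\<beta> / 2) *\<^sub>R (\<theta> k \<omega> - t)) \<mu> V"
  shows "(\<lambda>k. real k powr \<beta> * (\<integral>\<omega>. (norm (\<theta> k \<omega> - t))\<^sup>2 \<partial>M)) \<longlonglongrightarrow> (norm \<mu>)\<^sup>2 + trace V"
proof -
  have "(norm (real k powr (\<beta> / 2) *\<^sub>R x))\<^sup>2 = real k powr \<beta> * (norm x)\<^sup>2" for k and x :: "real ^ 'p"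
    by (simp add: power_mult_distrib power2_eq_square[of "_ powr _"] flip: powr_add)
  with second_moment_tendsto[OF _ conv] meas show ?thesis by simp
qed

end

section \<open>The limiting covariance matrix\<close>

lemma diagonal_mult_nth:
  fixes D X :: "real ^ 'p ^ 'p"
  assumes "\<And>i l. i \<noteq> l \<Longrightarrow> D $ i $ l = 0"
  shows "(D ** X) $ i $ l = D $ i $ i * X $ i $ l"
  using assms by (simp add: matrix_matrix_mult_def sum.remove[of UNIV i])

lemma diagonal_congruence_nth:
  fixes D X :: "real ^ 'p ^ 'p"
  assumes D: "\<And>i l. i \<noteq> l \<Longrightarrow> D $ i $ l = 0"
  shows "(D ** X ** transpose D) $ i $ i = (D $ i $ i)\<^sup>2 * X $ i $ i"
proof -
  have "(D ** X ** transpose D) $ i $ i = (D ** transpose (D ** X)) $ i $ i"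
    using matrix_transpose_mul[of D "transpose (D ** X)"]
    by (simp add: transpose_def vec_eq_iff)
  then show ?thesis
    by (simp add: diagonal_mult_nth[OF D] transpose_def power2_eq_square)
qed

lemma transpose_gain_matrix: "transpose (gain_matrix d blk c) = gain_matrix d blk c"
  by (auto simp: transpose_def gain_matrix_def vec_eq_iff)

lemma invertible_matrix_inv:
  fixes S :: "real ^ 'p ^ 'p"
  assumes "invertible S"
  shows "S ** matrix_inv S = mat 1" and "matrix_inv S ** S = mat 1"
proof -
  have "S ** matrix_inv S = mat 1 \<and> matrix_inv S ** S = mat 1"
    using assms unfolding invertible_def matrix_inv_def by (rule someI_ex)
  then show "S ** matrix_inv S = mat 1" and "matrix_inv S ** S = mat 1" by auto
qed

text \<open>With \<open>S\<close> scalar, \<open>\<Sigma>\<close> arises from \<open>M\<close> by congruences with diagonal matrices and an entrywise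
  division; each of these acts on the diagonal entries separately.\<close>

lemma limit_cov_diag_scalar_eigenbasis:
  fixes A M M' :: "real ^ 'p ^ 'p"
  assumes inv: "invertible (mat c :: real ^ 'p ^ 'p)"
    and A: "\<And>i l. i \<noteq> l \<Longrightarrow> A $ i $ l = 0" and sym: "transpose A = A"
    and diag: "\<And>i. M' $ i $ i = M $ i $ i"
  shows "limit_cov (mat c) \<Lambda> \<beta>p A M' $ i $ i = limit_cov (mat c) \<Lambda> \<beta>p A M $ i $ i"
proof -
  have mat_diag: "(mat x :: real ^ 'p ^ 'p) $ i $ l = 0" if "i \<noteq> l" for x i l
    using that by (simp add: mat_def)
  have "c \<noteq> 0"
    using inv by (auto simp: invertible_det_nz det_diagonal mat_def)
  then have "mat (inverse c) ** mat c = (mat 1 :: real ^ 'p ^ 'p)"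
    by (auto simp: vec_eq_iff diagonal_mult_nth mat_def)
  then have inv_mat: "matrix_inv (mat c :: real ^ 'p ^ 'p) = mat (inverse c)"
    by (metis inv invertible_matrix_inv(1) matrix_mul_assoc matrix_mul_lid matrix_mul_rid)
  have T: "(mat (inverse c) ** A) $ i $ l = 0" if "i \<noteq> l" for i l
    using A that by (simp add: diagonal_mult_nth[OF mat_diag[where x = "inverse c"]])
  \<comment> \<open>since \<open>A\<close> is symmetric, \<open>S\<inverse>AMA(S\<inverse>)\<^sup>T\<close> is the congruence of \<open>M\<close> by the diagonal matrix \<open>S\<inverse>A\<close>\<close>
  have Q: "limit_Q (mat c) \<Lambda> \<beta>p A N $ i $ i
      = ((mat (inverse c) ** A) $ i $ i)\<^sup>2 * N $ i $ i / (\<Lambda> $ i $ i + \<Lambda> $ i $ i - \<beta>p)" for N i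
    using diagonal_congruence_nth[OF T, where X = N and i = i]
    by (simp add: limit_Q_def inv_mat matrix_transpose_mul sym matrix_mul_assoc)
  show ?thesis
    unfolding limit_cov_def by (subst (1 2) diagonal_congruence_nth) (simp_all add: mat_diag Q diag)
qed

lemma invertible_congruence_eq_0_iff:
  fixes S X :: "real ^ 'p ^ 'p"
  assumes "invertible S"
  shows "S ** X ** transpose S = 0 \<longleftrightarrow> X = 0"
proof
  assume eq: "S ** X ** transpose S = 0"
  have inv: "matrix_inv S ** S = mat 1" using assms by (rule invertible_matrix_inv)
  have "X = (matrix_inv S ** S) ** X ** transpose (matrix_inv S ** S)"
    by (simp add: inv)
  also have "\<dots> = matrix_inv S ** (S ** X ** transpose S) ** transpose (matrix_inv S)"
    by (simp add: matrix_transpose_mul matrix_mul_assoc)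
  finally show "X = 0" by (simp add: eq)
qed simp

text \<open>Each step from \<open>AMA\<close> to \<open>\<Sigma>\<close> can be undone: \<open>S\<close> is invertible, and the bound on \<open>\<beta>p\<close> keeps the
  denominators \<open>\<Lambda>\<^sub>i\<^sub>i + \<Lambda>\<^sub>l\<^sub>l - \<beta>p\<close> positive.\<close>

lemma limit_cov_nonzero:
  fixes S A M \<Lambda> :: "real ^ 'p ^ 'p"
  assumes S: "invertible S" and pd: "pos_def (A ** M ** A)"
    and gap: "\<beta>p < 2 * (MIN i. \<Lambda> $ i $ i)"
  shows "limit_cov S \<Lambda> \<beta>p A M \<noteq> 0"
proof
  assume "limit_cov S \<Lambda> \<beta>p A M = 0"
  then have Q: "limit_Q S \<Lambda> \<beta>p A M = 0"
    by (simp add: limit_cov_def invertible_congruence_eq_0_iff[OF S])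
  have "(MIN i. \<Lambda> $ i $ i) \<le> \<Lambda> $ i $ i" for i by (rule Min_le) auto
  then have "\<Lambda> $ i $ i + \<Lambda> $ l $ l - \<beta>p > 0" for i l
    using gap by (smt (verit))
  then have denom: "\<Lambda> $ i $ i + \<Lambda> $ l $ l - \<beta>p \<noteq> 0" for i l
    by (metis less_irrefl)
  have "matrix_inv S ** (A ** M ** A) ** transpose (matrix_inv S) = 0"
    using Q denom by (simp add: limit_Q_def vec_eq_iff matrix_mul_assoc)
  then have "A ** M ** A = 0"
    using S invertible_congruence_eq_0_iff[of "matrix_inv S"] invertible_matrix_inv[OF S] invertible_def by blast
  moreover obtain v :: "real ^ 'p" where "v \<noteq> 0" using axis_eq_0_iff[of _ "1::real"] by (metis zero_neq_one)
  ultimately show False using pd by (auto simp: pos_def_def)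
qed

section \<open>Errors at iterations of equal cost\<close>

text \<open>Rates are compared along \<open>k1\<close> and \<open>k2\<close>: the common limit \<open>c\<close> cancels and the powers of the matched
  indices leave \<open>(k2 i / k1 i) powr \<beta> = (c1 / c2) powr \<beta>\<close>.\<close>

lemma tendsto_ratio_along_matched_indices:
  fixes e1 e2 :: "nat \<Rightarrow> real"
  assumes e1: "(\<lambda>k. real k powr \<beta> * e1 k) \<longlonglongrightarrow> c"
    and e2: "(\<lambda>k. real k powr \<beta> * e2 k) \<longlonglongrightarrow> c" and "c \<noteq> 0"
    and k1: "filterlim k1 at_top sequentially" and k2: "filterlim k2 at_top sequentially"
    and pos: "0 < c1" "0 < c2"
    and matched: "\<forall>\<^sub>F i in sequentially. c1 * real (k1 i) = c2 * real (k2 i)"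
  shows "(\<lambda>i. e1 (k1 i) / e2 (k2 i)) \<longlonglongrightarrow> (c1 / c2) powr \<beta>"
proof -
  have "(\<lambda>i. (c1 / c2) powr \<beta> * ((real (k1 i) powr \<beta> * e1 (k1 i)) / (real (k2 i) powr \<beta> * e2 (k2 i))))
      \<longlonglongrightarrow> (c1 / c2) powr \<beta> * (c / c)"
    using \<open>c \<noteq> 0\<close> filterlim_compose[OF e1 k1] filterlim_compose[OF e2 k2]
    by (intro tendsto_intros)
  moreover have "\<forall>\<^sub>F i in sequentially.
      (c1 / c2) powr \<beta> * ((real (k1 i) powr \<beta> * e1 (k1 i)) / (real (k2 i) powr \<beta> * e2 (k2 i)))
        = e1 (k1 i) / e2 (k2 i)"
    using matched eventually_compose_filterlim[OF eventually_gt_at_top[of 0] k1]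
      eventually_compose_filterlim[OF eventually_gt_at_top[of 0] k2]
  proof eventually_elim
    case (elim i)
    then have "real (k2 i) = (c1 / c2) * real (k1 i)" using pos by (simp add: field_simps)
    then have "real (k2 i) powr \<beta> = (c1 / c2) powr \<beta> * real (k1 i) powr \<beta>"
      using pos by (simp only: powr_mult)
    then show ?case using elim pos by simp
  qed
  ultimately show ?thesis using \<open>c \<noteq> 0\<close> by (auto dest: Lim_transform_eventually)
qed

lemma filterlim_strict_mono_on_from_1:
  fixes k :: "nat \<Rightarrow> nat"
  assumes "strict_mono_on {1..} k"
  shows "filterlim k at_top sequentially"
proof -
  have "strict_mono (\<lambda>i. k (Suc i))"
    using assms by (auto simp: strict_mono_def strict_mono_on_def)
  then show ?thesis
    by (subst filterlim_sequentially_Suc[symmetric]) (rule filterlim_subseq)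
qed

section \<open>Measurability of the iterates\<close>

lemma matrix_vector_mult_borel_measurable:
  fixes D :: "real ^ 'p ^ 'q"
  assumes "X \<in> borel_measurable P"
  shows "(\<lambda>\<omega>. D *v X \<omega>) \<in> borel_measurable P"
  by (rule borel_measurable_continuous_on[OF _ assms])
    (intro linear_continuous_on matrix_vector_mul_bounded_linear)

lemma block_part_borel_measurable:
  fixes X :: "'w \<Rightarrow> real ^ 'p"
  assumes "X \<in> borel_measurable P"
  shows "(\<lambda>\<omega>. block_part B (X \<omega>)) \<in> borel_measurable P"
proof -
  have "continuous_on UNIV (\<lambda>v. if i \<in> B then v $ i else (0::real))" for i :: 'p
    by (cases "i \<in> B") (auto intro!: continuous_intros)
  then have "continuous_on UNIV (\<lambda>v :: real ^ 'p. block_part B v)"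
    unfolding block_part_def by (rule continuous_on_vec_lambda)
  then show ?thesis by (rule borel_measurable_continuous_on[OF _ assms])
qed

text \<open>The gradient, bias and noise of a cyclic step are separated, because measurability is
  assumed for the bias and the noise blocks individually.\<close>

lemma block_part_add: "block_part B (x + y) = block_part B x + block_part B y"
  by (simp add: block_part_def vec_eq_iff)

text \<open>Without measurable iterates, integrability of the squared norms would not provide the
  coordinate means and covariances of the second moment identities.\<close>

lemma cyclic_iterates_borel_measurable:
  fixes \<theta>cyc :: "nat \<Rightarrow> 'w \<Rightarrow> real ^ 'p"
  assumes g: "g \<in> borel_measurable borel"
    and init: "\<theta>cyc 0 \<in> borel_measurable P"
    and start: "\<And>k \<omega>. \<omega> \<in> space P \<Longrightarrow> \<theta>I k 0 \<omega> = \<theta>cyc k \<omega>"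
    and step: "\<And>k j \<omega>. j \<in> {1..d} \<Longrightarrow> \<omega> \<in> space P \<Longrightarrow> \<theta>I k j \<omega> = \<theta>I k (j - 1) \<omega>
        - a k j *\<^sub>R cyc_eval blk (\<lambda>k x \<omega>. g x + bias k x \<omega> + noise k x \<omega>) \<theta>I k j \<omega>"
    and after: "\<And>k \<omega>. \<omega> \<in> space P \<Longrightarrow> \<theta>cyc (Suc k) \<omega> = \<theta>I k d \<omega>"
    and bias: "\<And>k j. j \<in> {1..d} \<Longrightarrow> cyc_eval blk bias \<theta>I k j \<in> borel_measurable P"
    and noise: "\<And>k j. j \<in> {1..d} \<Longrightarrow> cyc_eval blk noise \<theta>I k j \<in> borel_measurable P"
  shows "\<theta>cyc k \<in> borel_measurable P"
proof (induction k)
  case (Suc k)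
  have "j \<le> d \<Longrightarrow> \<theta>I k j \<in> borel_measurable P" for j
  proof (induction j)
    case 0
    show ?case using Suc by (simp cong: measurable_cong add: start)
  next
    case (Suc j)
    then have j: "Suc j \<in> {1..d}" and prev: "\<theta>I k j \<in> borel_measurable P" by auto
    have "(\<lambda>\<omega>. \<theta>I k j \<omega> - a k (Suc j) *\<^sub>R (block_part (blk (Suc j)) (g (\<theta>I k j \<omega>))
        + cyc_eval blk bias \<theta>I k (Suc j) \<omega> + cyc_eval blk noise \<theta>I k (Suc j) \<omega>)) \<in> borel_measurable P"
      by (intro borel_measurable_diff borel_measurable_scaleR borel_measurable_add borel_measurable_const
          block_part_borel_measurable measurable_compose[OF prev g] bias[OF j] noise[OF j] prev)
    then show ?case
      using step[OF j] by (simp cong: measurable_cong add: cyc_eval_def block_part_add)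
  qed
  then show ?case by (simp cong: measurable_cong add: after)
qed (rule init)

lemma noncyclic_iterates_borel_measurable:
  fixes \<theta> :: "nat \<Rightarrow> 'w \<Rightarrow> real ^ 'p"
  assumes g: "g \<in> borel_measurable borel"
    and init: "\<theta> 0 \<in> borel_measurable P"
    and step: "\<And>k \<omega>. \<omega> \<in> space P \<Longrightarrow> \<theta> (Suc k) \<omega> = \<theta> k \<omega>
        - D k *v non_eval (\<lambda>k x \<omega>. g x + bias k x \<omega> + noise k x \<omega>) \<theta> k \<omega>"
    and bias: "\<And>k. non_eval bias \<theta> k \<in> borel_measurable P"
    and noise: "\<And>k. non_eval noise \<theta> k \<in> borel_measurable P"
  shows "\<theta> k \<in> borel_measurable P"
proof (induction k)
  case (Suc k)
  have "(\<lambda>\<omega>. \<theta> k \<omega> - D k *v (g (\<theta> k \<omega>) + non_eval bias \<theta> k \<omega> + non_eval noise \<theta> k \<omega>))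
      \<in> borel_measurable P"
    by (intro borel_measurable_diff borel_measurable_add matrix_vector_mult_borel_measurable
        measurable_compose[OF Suc g] bias noise Suc)
  then show ?case by (simp cong: measurable_cong add: step non_eval_def)
qed (rule init)

theorem proposition4:
  fixes P :: "'w measure"
    and L :: "real ^ 'p \<Rightarrow> real" and g :: "real ^ 'p \<Rightarrow> real ^ 'p"
    and H :: "real ^ 'p \<Rightarrow> real ^ 'p ^ 'p" and \<theta>s :: "real ^ 'p"
    and d :: nat and blk :: "nat \<Rightarrow> 'p set"
    and bias noise ghat :: "nat \<Rightarrow> real ^ 'p \<Rightarrow> 'w \<Rightarrow> real ^ 'p"
    and a :: "nat \<Rightarrow> nat \<Rightarrow> real" and r :: "nat \<Rightarrow> real" and \<alpha> \<beta> \<beta>p :: real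
    and A S \<Lambda> :: "real ^ 'p ^ 'p"
    and \<theta>I :: "nat \<Rightarrow> nat \<Rightarrow> 'w \<Rightarrow> real ^ 'p"
    and \<theta>cyc \<theta>non :: "nat \<Rightarrow> 'w \<Rightarrow> real ^ 'p"
    and Vcyc Vnon :: "nat \<Rightarrow> ('w \<Rightarrow> real) set"
    and b :: "nat \<Rightarrow> real ^ 'p" and bcyc bnon :: "real ^ 'p"
    and Sig :: "nat \<Rightarrow> real ^ 'p ^ 'p" and MB M :: "real ^ 'p ^ 'p"
    and Ccyc Cnon ccyc cnon :: real and k1 k2 :: "nat \<Rightarrow> nat"
  assumes prob: "prob_space P"
    \<comment> \<open>loss function, blocks, noisy gradients\<close>
    and grad: "\<And>x. GDERIV L x :> g x"
    and hess: "\<And>x. (g has_derivative (\<lambda>h. H x *v h)) (at x)"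
    and hess_cont: "continuous_on UNIV H"
    and hess_bdd: "\<exists>B. \<forall>x i l. \<bar>H x $ i $ l\<bar> \<le> B"
    and root: "g \<theta>s = 0"
    and blk_disj: "disjoint_family_on blk {1..d}"
    and blk_cover: "(\<Union>j\<in>{1..d}. blk j) = UNIV"
    and ghat_def: "ghat = (\<lambda>k x \<omega>. g x + bias k x \<omega> + noise k x \<omega>)"
    \<comment> \<open>cyclic algorithm; \<open>\<theta>I k j\<close> is the intermediate iterate after \<open>j\<close> blocks\<close>
    and cyc_init: "\<theta>cyc 0 \<in> borel_measurable P"
    and cyc_start: "\<And>k \<omega>. \<omega> \<in> space P \<Longrightarrow> \<theta>I k 0 \<omega> = \<theta>cyc k \<omega>"
    and cyc_step: "\<And>k j \<omega>. j \<in> {1..d} \<Longrightarrow> \<omega> \<in> space P \<Longrightarrow>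
        \<theta>I k j \<omega> = \<theta>I k (j - 1) \<omega> - a k j *\<^sub>R cyc_eval blk ghat \<theta>I k j \<omega>"
    and cyc_next: "\<And>k \<omega>. \<omega> \<in> space P \<Longrightarrow> \<theta>cyc (Suc k) \<omega> = \<theta>I k d \<omega>"
    \<comment> \<open>non-cyclic algorithm with the same gains\<close>
    and non_init: "\<theta>non 0 \<in> borel_measurable P"
    and non_step: "\<And>k \<omega>. \<omega> \<in> space P \<Longrightarrow>
        \<theta>non (Suc k) \<omega> = \<theta>non k \<omega> - gain_matrix d blk (a k) *v non_eval ghat \<theta>non k \<omega>"
    \<comment> \<open>conditions common to both algorithms\<close>
    and gain_pos: "\<And>k j. j \<in> {1..d} \<Longrightarrow> 0 < a k j"
    and gain_lim: "\<And>j. j \<in> {1..d} \<Longrightarrow> (\<lambda>k. real k powr \<alpha> * a k j) \<longlonglongrightarrow> r j"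
    and A_def: "A = gain_matrix d blk r"
    and S_inv: "invertible S"
    and \<Lambda>_diag: "\<And>i l. i \<noteq> l \<Longrightarrow> \<Lambda> $ i $ l = 0"
    and \<Lambda>_pos: "\<And>i. 0 < \<Lambda> $ i $ i"
    and AH: "A ** H \<theta>s = S ** \<Lambda> ** matrix_inv S"
    and exponents: "0 < \<beta>" "\<beta> \<le> \<alpha>" "\<alpha> \<le> 1"
    and \<beta>p_def: "\<beta>p = beta_plus \<alpha> \<beta>"
    and \<beta>p_less: "\<beta>p < 2 * (MIN i. \<Lambda> $ i $ i)"
    \<comment> \<open>cyclic conditions\<close>
    and cyc_meas: "\<And>k j. j \<in> {1..d} \<Longrightarrow> cyc_eval blk bias \<theta>I k j \<in> borel_measurable P"
        "\<And>k j. j \<in> {1..d} \<Longrightarrow> cyc_eval blk noise \<theta>I k j \<in> borel_measurable P"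
    and cyc_L2: "\<And>k j. j \<in> {1..d} \<Longrightarrow> integrable P (\<lambda>\<omega>. (norm (cyc_eval blk noise \<theta>I k j \<omega>))\<^sup>2)"
    and cyc_hist: "\<And>k. Vcyc k \<subseteq> borel_measurable P"
        "\<And>k j. j \<in> {1..d} \<Longrightarrow> coords (cyc_eval blk ghat \<theta>I k j) \<subseteq> Vcyc (Suc k)"
    and cyc_conv: "\<And>j. j \<le> d \<Longrightarrow> AE \<omega> in P. (\<lambda>k. \<theta>I k j \<omega>) \<longlonglongrightarrow> \<theta>s"
    and cyc_bias: "\<And>j. j \<in> {1..d} \<Longrightarrow>
        AE \<omega> in P. (\<lambda>k. real k powr (\<beta> / 2) *\<^sub>R cyc_eval blk bias \<theta>I k j \<omega>) \<longlonglongrightarrow> b j"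
    and bcyc_def: "bcyc = (\<Sum>j=1..d. b j)"
    and cyc_mean: "\<And>k j. j \<in> {1..d} \<Longrightarrow>
        cond_mean_zero P (cyc_eval blk noise \<theta>I k j) (\<theta>I k (j - 1))"
    and Ccyc_pos: "0 < Ccyc"
    and cyc_cov: "\<And>j. j \<in> {1..d} \<Longrightarrow> bounded_null P Ccyc (\<lambda>k \<omega>.
        real k powr (\<beta> - \<alpha>) *\<^sub>R cond_cross_moment P (history P \<theta>cyc Vcyc k)
          (cyc_eval blk noise \<theta>I k j) (cyc_eval blk noise \<theta>I k j) \<omega> - Sig j)"
    and cyc_cross: "\<And>j j'. j \<in> {1..d} \<Longrightarrow> j' \<in> {1..d} \<Longrightarrow> j \<noteq> j' \<Longrightarrow> bounded_null P Ccyc (\<lambda>k \<omega>.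
        real k powr (\<beta> - \<alpha>) *\<^sub>R cond_cross_moment P (history P \<theta>cyc Vcyc k)
          (cyc_eval blk noise \<theta>I k j) (cyc_eval blk noise \<theta>I k j') \<omega>)"
    and MB_def: "MB = (\<Sum>j=1..d. Sig j)"
    and cyc_pd: "pos_def (A ** MB ** A)"
    and cyc_lindeberg: "\<And>j. j \<in> {1..d} \<Longrightarrow> lindeberg_condition P \<alpha>
        (\<lambda>k \<omega>. real k powr ((\<beta> - \<alpha>) / 2) *\<^sub>R cyc_eval blk noise \<theta>I k j \<omega>)"
    \<comment> \<open>non-cyclic conditions\<close>
    and non_meas: "\<And>k. non_eval bias \<theta>non k \<in> borel_measurable P"
        "\<And>k. non_eval noise \<theta>non k \<in> borel_measurable P"
    and non_L2: "\<And>k. integrable P (\<lambda>\<omega>. (norm (non_eval noise \<theta>non k \<omega>))\<^sup>2)"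
    and non_hist: "\<And>k. Vnon k \<subseteq> borel_measurable P"
        "\<And>k. coords (non_eval ghat \<theta>non k) \<subseteq> Vnon (Suc k)"
    and non_conv: "AE \<omega> in P. (\<lambda>k. \<theta>non k \<omega>) \<longlonglongrightarrow> \<theta>s"
    and non_bias: "AE \<omega> in P. (\<lambda>k. real k powr (\<beta> / 2) *\<^sub>R non_eval bias \<theta>non k \<omega>) \<longlonglongrightarrow> bnon"
    and non_mean: "\<And>k. cond_mean_zero P (non_eval noise \<theta>non k) (\<theta>non k)"
    and Cnon_pos: "0 < Cnon"
    and non_cov: "bounded_null P Cnon (\<lambda>k \<omega>.
        real k powr (\<beta> - \<alpha>) *\<^sub>R cond_cross_moment P (history P \<theta>non Vnon k)
          (non_eval noise \<theta>non k) (non_eval noise \<theta>non k) \<omega> - M)"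
    and non_pd: "pos_def (A ** M ** A)"
    and non_lindeberg: "lindeberg_condition P \<alpha>
        (\<lambda>k \<omega>. real k powr ((\<beta> - \<alpha>) / 2) *\<^sub>R non_eval noise \<theta>non k \<omega>)"
    \<comment> \<open>both algorithms have the same limiting noise variance in each coordinate; automatic
          under (ii) below, but not a consequence of the other conditions under (i)\<close>
    and noise_var: "\<And>i. MB $ i $ i = M $ i $ i"
    \<comment> \<open>means and covariance matrices converge to those of the limiting normal distributions\<close>
    and cyc_moments: "moments_converge P (\<lambda>k \<omega>. real k powr (\<beta> / 2) *\<^sub>R (\<theta>cyc k \<omega> - \<theta>s))
        (limit_mean S \<Lambda> \<beta>p A bcyc) (limit_cov S \<Lambda> \<beta>p A MB)"
    and non_moments: "moments_converge P (\<lambda>k \<omega>. real k powr (\<beta> / 2) *\<^sub>R (\<theta>non k \<omega> - \<theta>s))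
        (limit_mean S \<Lambda> \<beta>p A bnon) (limit_cov S \<Lambda> \<beta>p A M)"
    \<comment> \<open>costs and matched iteration numbers\<close>
    and costs: "0 < ccyc" "0 < cnon" "ccyc / cnon \<in> \<rat>"
    and k1: "strict_mono_on {1..} k1" "\<And>i. 1 \<le> i \<Longrightarrow> 0 < k1 i"
    and k2: "strict_mono_on {1..} k2" "\<And>i. 1 \<le> i \<Longrightarrow> 0 < k2 i"
    and matched: "\<And>i. 1 \<le> i \<Longrightarrow> ccyc * real (k1 i) = cnon * real (k2 i)"
    \<comment> \<open>equal bias limits, and one of (i) and (ii)\<close>
    and same_bias: "bcyc = bnon"
    and i_or_ii: "(\<exists>c. S = mat c) \<or> MB = M"
  shows "(\<lambda>i. (\<integral>\<omega>. (norm (\<theta>cyc (k1 i) \<omega> - \<theta>s))\<^sup>2 \<partial>P) / (\<integral>\<omega>. (norm (\<theta>non (k2 i) \<omega> - \<theta>s))\<^sup>2 \<partial>P))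
           \<longlonglongrightarrow> (ccyc / cnon) powr \<beta>"
proof -
  interpret prob_space P by (rule prob)
  have g_meas: "g \<in> borel_measurable borel"
    using hess by (intro borel_measurable_continuous_onI)
      (auto simp: continuous_on_eq_continuous_at intro: has_derivative_continuous)
  have cyc: "\<theta>cyc k \<in> borel_measurable P" for k
    by (rule cyclic_iterates_borel_measurable[OF g_meas cyc_init cyc_start
          cyc_step[unfolded ghat_def] cyc_next cyc_meas])
  have non: "\<theta>non k \<in> borel_measurable P" for k
    by (rule noncyclic_iterates_borel_measurable[OF g_meas non_init
          non_step[unfolded ghat_def] non_meas])
  let ?Vcyc = "limit_cov S \<Lambda> \<beta>p A MB" and ?Vnon = "limit_cov S \<Lambda> \<beta>p A M"
  let ?c = "(norm (limit_mean S \<Lambda> \<beta>p A bnon))\<^sup>2 + trace ?Vnon"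
  have A_diag: "A $ i $ l = 0" if "i \<noteq> l" for i l
    using that by (simp add: A_def gain_matrix_def)
  have A_sym: "transpose A = A" by (simp add: A_def transpose_gain_matrix)
  have trace_eq: "trace ?Vcyc = trace ?Vnon"
    using i_or_ii
  proof
    assume "\<exists>c. S = mat c"
    then obtain c where S: "S = mat c" by blast
    show ?thesis
      using limit_cov_diag_scalar_eigenbasis[OF S_inv[unfolded S] A_diag A_sym noise_var]
      by (simp add: trace_def S)
  qed simp
  have "0 < trace ?Vnon"
    using trace_limit_cov_pos[OF _ non_moments limit_cov_nonzero[OF S_inv non_pd \<beta>p_less]] non
    by simp
  then have nz: "?c \<noteq> 0" by (smt (verit) zero_le_power2)
  have lim_cyc: "(\<lambda>k. real k powr \<beta> * (\<integral>\<omega>. (norm (\<theta>cyc k \<omega> - \<theta>s))\<^sup>2 \<partial>P)) \<longlonglongrightarrow> ?c"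
    using scaled_mean_square_error_tendsto[OF cyc cyc_moments] by (simp add: trace_eq same_bias)
  note lim_non = scaled_mean_square_error_tendsto[OF non non_moments]
  have "\<forall>\<^sub>F i in sequentially. ccyc * real (k1 i) = cnon * real (k2 i)"
    using eventually_ge_at_top[of 1] by eventually_elim (rule matched)
  then show ?thesis
    by (rule tendsto_ratio_along_matched_indices[OF lim_cyc lim_non nz
          filterlim_strict_mono_on_from_1[OF k1(1)]
          filterlim_strict_mono_on_from_1[OF k2(1)] costs(1,2)])
qed

end
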